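(* Let $X$ be a finite cell complex, $q$ a prime integer, $i$ a non-negative integer, $p_2,p_1\in[0,1]$, and let $\rho=\rho_{p_2,p_1,q,i,X}$ be the coupled plaquette percolation measure. Then $\rho$ is positively associated: if $A$ and $B$ are events that are increasing with respect to $(P_2,P_1)$, then $$\rho(A\cap B)\geq \rho(A)\rho(B).$$
   Context: For a cell complex $X$: $X^{[j]}$ is the set of $j$-cells and $X^{(j)}$ the $j$-skeleton. $C^j(X;\mathbb{Z}_q)$ is the group of functions $f$ from oriented $j$-cells to $\mathbb{Z}_q$ (integers modulo $q$) with $f(-x)=-f(x)$; $\delta f(x)=f(\partial x)$ with $\partial$ the cellular boundary. A $j$-dimensional percolation subcomplex of $X$ is a subcomplex $P$ with $X^{(j-1)}\subseteq P\subseteq X^{(j)}$; $|P|$ is its number of $j$-cells. The coupled plaquette percolation $\rho_{p_2,p_1,q,i,X}$ is the probability measure on pairs $(P_2,P_1)$ of percolation subcomplexes of $X$ of dimensions $i+1$ and $i$ with $$\rho(P_2,P_1)\propto p_2^{|P_2|}(1-p_2)^{|X^{[i+1]}|-|P_2|}\,p_1^{|P_1|}(1-p_1)^{|X^{[i]}|-|P_1|}\,|H^i(P_2,P_1;\mathbb{Z}_q)|,$$ where the relative cohomology $H^i(P_2,P_1;\mathbb{Z}_q)$ coincides with the group of $f\in C^i(X;\mathbb{Z}_q)$ such that $f(\epsilon)=0$ for all $i$-cells $\epsilon$ of $P_1$ and $\delta f(\sigma)=0$ for all $(i+1)$-cells $\sigma$ of $P_2$. An event is increasing if it is preserved under adding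 $(i+1)$-cells to $P_2$ and $i$-cells to $P_1$. *)

theory Defs
  imports "HOL-Homology.Homology" "HOL-Probability.Probability"
    "HOL-Computational_Algebra.Primes"
begin

section \<open>Finite cell complexes\<close>

text \<open>The disc has the unit sphere of \<open>Euclidean_space n\<close> as its boundary: this is
  \<open>nsphere (n - 1)\<close> if \<open>n > 0\<close>, and it is empty if \<open>n = 0\<close>.\<close>

definition closed_disc :: "nat \<Rightarrow> (nat \<Rightarrow> real) set" where
  "closed_disc n = {x \<in> topspace (Euclidean_space n). (\<Sum>k<n. x k ^ 2) \<le> 1}"

definition open_disc :: "nat \<Rightarrow> (nat \<Rightarrow> real) set" where
  "open_disc n = {x \<in> topspace (Euclidean_space n). (\<Sum>k<n. x k ^ 2) < 1}"

definition disc_boundary :: "nat \<Rightarrow> (nat \<Rightarrow> real) set" where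
  "disc_boundary n = {x \<in> topspace (Euclidean_space n). (\<Sum>k<n. x k ^ 2) = 1}"

record ('a, 'c) cell_complex =
  total_space :: "'a topology"
  cells :: "'c set"
  cell_dim :: "'c \<Rightarrow> nat"
  char_map :: "'c \<Rightarrow> (nat \<Rightarrow> real) \<Rightarrow> 'a"

definition open_cell :: "('a, 'c) cell_complex \<Rightarrow> 'c \<Rightarrow> 'a set" where
  "open_cell X c = char_map X c ` open_disc (cell_dim X c)"

text \<open>Finite CW complexes, presented by their characteristic maps. As there are only finitely
  many cells, closure-finiteness and the weak topology are automatic.\<close>

definition finite_cell_complex :: "('a, 'c) cell_complex \<Rightarrow> bool" where
  "finite_cell_complex X \<longleftrightarrow>
     Hausdorff_space (total_space X) \<and>
     finite (cells X) \<and>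
     topspace (total_space X) = (\<Union>c\<in>cells X. open_cell X c) \<and>
     disjoint_family_on (open_cell X) (cells X) \<and>
     (\<forall>c\<in>cells X.
        continuous_map (subtopology (Euclidean_space (cell_dim X c)) (closed_disc (cell_dim X c)))
          (total_space X) (char_map X c) \<and>
        embedding_map (subtopology (Euclidean_space (cell_dim X c)) (open_disc (cell_dim X c)))
          (total_space X) (char_map X c) \<and>
        char_map X c ` disc_boundary (cell_dim X c)
          \<subseteq> (\<Union>d\<in>{d \<in> cells X. cell_dim X d < cell_dim X c}. open_cell X d))"

text \<open>Subcomplexes are identified with their sets of cells.\<close>

definition subcomplex :: "('a, 'c) cell_complex \<Rightarrow> 'c set \<Rightarrow> bool" where
  "subcomplex X P \<longleftrightarrow> P \<subseteq> cells X \<and>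
     (\<forall>c\<in>P. char_map X c ` closed_disc (cell_dim X c) \<subseteq> (\<Union>d\<in>P. open_cell X d))"

definition cells_of_dim :: "('a, 'c) cell_complex \<Rightarrow> 'c set \<Rightarrow> nat \<Rightarrow> 'c set" where
  "cells_of_dim X P j = {c \<in> P. cell_dim X c = j}"

definition skeleton :: "('a, 'c) cell_complex \<Rightarrow> int \<Rightarrow> 'c set" where
  "skeleton X j = {c \<in> cells X. int (cell_dim X c) \<le> j}"

section \<open>The cellular boundary\<close>

text \<open>\<open>disc_collapse m\<close> maps the open disc homeomorphically onto the complement of
  \<open>south_pole m\<close> in \<open>nsphere m\<close>, and the whole boundary to \<open>south_pole m\<close>. It thus induces the
  identification of the quotient of the disc by its boundary with \<open>nsphere m\<close>.\<close>

definition south_pole :: "nat \<Rightarrow> nat \<Rightarrow> real" where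
  "south_pole m = (\<lambda>k. if k = m then - 1 else 0)"

definition disc_collapse :: "nat \<Rightarrow> (nat \<Rightarrow> real) \<Rightarrow> nat \<Rightarrow> real" where
  "disc_collapse m x =
     (let r2 = (\<Sum>k<m. x k ^ 2)
      in (\<lambda>k. if k < m then 2 * sqrt (1 - r2) * x k else if k = m then 1 - 2 * r2 else 0))"

text \<open>For \<open>\<epsilon>\<close> of dimension \<open>m\<close> and \<open>\<sigma>\<close> of dimension \<open>m + 1\<close>, this is the composition of the
  attaching map of \<open>\<sigma>\<close> with the collapse of the complement of the open cell \<open>\<epsilon>\<close> in the
  \<open>m\<close>-skeleton; its degree is the coefficient of \<open>\<epsilon>\<close> in the cellular boundary of \<open>\<sigma>\<close>. The
  library's degree uses reduced homology, so that the case \<open>m = 0\<close> is included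
  (see \<open>incidence_number_edge\<close> below).\<close>

definition attaching_quotient ::
  "('a, 'c) cell_complex \<Rightarrow> 'c \<Rightarrow> 'c \<Rightarrow> (nat \<Rightarrow> real) \<Rightarrow> nat \<Rightarrow> real" where
  "attaching_quotient X \<sigma> \<epsilon> s =
     (let m = cell_dim X \<epsilon>; y = char_map X \<sigma> s
      in if y \<in> open_cell X \<epsilon> then disc_collapse m (inv_into (open_disc m) (char_map X \<epsilon>) y)
         else south_pole m)"

definition incidence_number :: "('a, 'c) cell_complex \<Rightarrow> 'c \<Rightarrow> 'c \<Rightarrow> int" where
  "incidence_number X \<sigma> \<epsilon> = Brouwer_degree2 (cell_dim X \<epsilon>) (attaching_quotient X \<sigma> \<epsilon>)"

text \<open>An oriented cell is a cell with a sign; \<open>True\<close> is the orientation given by the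
  characteristic map. Chains are integer combinations of cells in this orientation.\<close>

type_synonym 'c oriented_cell = "'c \<times> bool"

definition oriented_cells ::
  "('a, 'c) cell_complex \<Rightarrow> 'c set \<Rightarrow> nat \<Rightarrow> 'c oriented_cell set" where
  "oriented_cells X P j = cells_of_dim X P j \<times> UNIV"

definition reverse_cell :: "'c oriented_cell \<Rightarrow> 'c oriented_cell" where
  "reverse_cell x = (fst x, \<not> snd x)"

definition cell_boundary :: "('a, 'c) cell_complex \<Rightarrow> 'c oriented_cell \<Rightarrow> 'c \<Rightarrow> int" where
  "cell_boundary X x \<epsilon> = (if snd x then 1 else - 1) * incidence_number X (fst x) \<epsilon>"

section \<open>Relative cellular cohomology with coefficients in the integers modulo \<open>q\<close>\<close>

text \<open>The integers modulo \<open>q\<close> are represented by the residues \<open>{0..<int q}\<close>. Below, \<open>P\<close> and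
  \<open>Q\<close> are subcomplexes of \<open>X\<close> with \<open>Q \<subseteq> P\<close>, and \<open>P\<close> plays the role of the ambient complex.\<close>

definition cochains ::
  "nat \<Rightarrow> ('a, 'c) cell_complex \<Rightarrow> 'c set \<Rightarrow> nat \<Rightarrow> ('c oriented_cell \<Rightarrow> int) set" where
  "cochains q X P j =
     {f \<in> oriented_cells X P j \<rightarrow>\<^sub>E {0..<int q}.
        \<forall>x\<in>oriented_cells X P j. f (reverse_cell x) = (- f x) mod int q}"

definition coboundary ::
  "nat \<Rightarrow> ('a, 'c) cell_complex \<Rightarrow> 'c set \<Rightarrow> nat \<Rightarrow>
     ('c oriented_cell \<Rightarrow> int) \<Rightarrow> 'c oriented_cell \<Rightarrow> int" where
  "coboundary q X P j f =
     (\<lambda>x\<in>oriented_cells X P (Suc j).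
        (\<Sum>\<epsilon>\<in>cells_of_dim X P j. cell_boundary X x \<epsilon> * f (\<epsilon>, True)) mod int q)"

definition relative_cochains ::
  "nat \<Rightarrow> ('a, 'c) cell_complex \<Rightarrow> 'c set \<Rightarrow> 'c set \<Rightarrow> nat \<Rightarrow>
     ('c oriented_cell \<Rightarrow> int) set" where
  "relative_cochains q X P Q j =
     {f \<in> cochains q X P j. \<forall>x\<in>oriented_cells X Q j. f x = 0}"

definition relative_cocycles ::
  "nat \<Rightarrow> ('a, 'c) cell_complex \<Rightarrow> 'c set \<Rightarrow> 'c set \<Rightarrow> nat \<Rightarrow>
     ('c oriented_cell \<Rightarrow> int) set" where
  "relative_cocycles q X P Q j =
     {f \<in> relative_cochains q X P Q j.
        \<forall>x\<in>oriented_cells X P (Suc j). coboundary q X P j f x = 0}"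

definition relative_coboundaries ::
  "nat \<Rightarrow> ('a, 'c) cell_complex \<Rightarrow> 'c set \<Rightarrow> 'c set \<Rightarrow> nat \<Rightarrow>
     ('c oriented_cell \<Rightarrow> int) set" where
  "relative_coboundaries q X P Q j =
     (case j of 0 \<Rightarrow> {\<lambda>x\<in>oriented_cells X P 0. 0}
      | Suc k \<Rightarrow> coboundary q X P k ` relative_cochains q X P Q k)"

definition relative_cohomology ::
  "nat \<Rightarrow> ('a, 'c) cell_complex \<Rightarrow> 'c set \<Rightarrow> 'c set \<Rightarrow> nat \<Rightarrow>
     ('c oriented_cell \<Rightarrow> int) set set" where
  "relative_cohomology q X P Q j =
     relative_cocycles q X P Q j //
       {(f, g). f \<in> relative_cocycles q X P Q j \<and> g \<in> relative_cocycles q X P Q j \<and>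
          (\<exists>h\<in>relative_coboundaries q X P Q j.
             \<forall>x\<in>oriented_cells X P j. f x = (g x + h x) mod int q)}"

section \<open>Coupled plaquette percolation\<close>

definition percolation_subcomplexes :: "('a, 'c) cell_complex \<Rightarrow> nat \<Rightarrow> 'c set set" where
  "percolation_subcomplexes X j =
     {P. subcomplex X P \<and> skeleton X (int j - 1) \<subseteq> P \<and> P \<subseteq> skeleton X (int j)}"

definition coupled_configs :: "('a, 'c) cell_complex \<Rightarrow> nat \<Rightarrow> ('c set \<times> 'c set) set" where
  "coupled_configs X i = percolation_subcomplexes X (Suc i) \<times> percolation_subcomplexes X i"

definition bernoulli_weight ::
  "('a, 'c) cell_complex \<Rightarrow> nat \<Rightarrow> real \<Rightarrow> 'c set \<Rightarrow> real" where
  "bernoulli_weight X j p P =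
     p ^ card (cells_of_dim X P j) *
     (1 - p) ^ (card (cells_of_dim X (cells X) j) - card (cells_of_dim X P j))"

definition coupled_weight ::
  "real \<Rightarrow> real \<Rightarrow> nat \<Rightarrow> nat \<Rightarrow> ('a, 'c) cell_complex \<Rightarrow> 'c set \<times> 'c set \<Rightarrow> real" where
  "coupled_weight p2 p1 q i X = (\<lambda>(P2, P1).
     bernoulli_weight X (Suc i) p2 P2 * bernoulli_weight X i p1 P1 *
     real (card (relative_cohomology q X P2 P1 i)))"

definition coupled_plaquette_percolation ::
  "real \<Rightarrow> real \<Rightarrow> nat \<Rightarrow> nat \<Rightarrow> ('a, 'c) cell_complex \<Rightarrow> ('c set \<times> 'c set) measure" where
  "coupled_plaquette_percolation p2 p1 q i X =
     point_measure (coupled_configs X i)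
       (\<lambda>\<omega>. ennreal (coupled_weight p2 p1 q i X \<omega> /
                      (\<Sum>\<eta>\<in>coupled_configs X i. coupled_weight p2 p1 q i X \<eta>)))"

definition increasing_event ::
  "('a, 'c) cell_complex \<Rightarrow> nat \<Rightarrow> ('c set \<times> 'c set) set \<Rightarrow> bool" where
  "increasing_event X i A \<longleftrightarrow> A \<subseteq> coupled_configs X i \<and>
     (\<forall>P2 P1 S2 S1. (P2, P1) \<in> A \<longrightarrow> S2 \<subseteq> cells_of_dim X (cells X) (Suc i) \<longrightarrow>
        S1 \<subseteq> cells_of_dim X (cells X) i \<longrightarrow> (P2 \<union> S2, P1 \<union> S1) \<in> A)"

section \<open>Consistency of the definitions\<close>

lemma disc_split: "closed_disc n = open_disc n \<union> disc_boundary n"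
  by (auto simp: closed_disc_def open_disc_def disc_boundary_def)

lemma incidence_number_edge:
  assumes \<epsilon>: "cell_dim X \<epsilon> = 0"
  defines "n \<equiv> (\<lambda>k. if k = 0 then 1 else 0) :: nat \<Rightarrow> real"
    and "s \<equiv> (\<lambda>k. if k = 0 then - 1 else 0) :: nat \<Rightarrow> real"
  shows "incidence_number X \<sigma> \<epsilon> =
    of_bool (char_map X \<sigma> n \<in> open_cell X \<epsilon>) - of_bool (char_map X \<sigma> s \<in> open_cell X \<epsilon>)"
proof -
  let ?f = "attaching_quotient X \<sigma> \<epsilon>"
  let ?N = "char_map X \<sigma> n \<in> open_cell X \<epsilon>" and ?S = "char_map X \<sigma> s \<in> open_cell X \<epsilon>"
  have ns: "x = n \<or> x = s" if "x \<in> topspace (nsphere 0)" for x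
  proof -
    have a: "x 0 ^ 2 = 1" "\<forall>i\<ge>Suc 0. x i = 0"
      using that by (auto simp: nsphere)
    then have "x 0 = 1 \<or> x 0 = - 1" by (simp add: power2_eq_1_iff)
    moreover have "x k = 0" if "k \<noteq> 0" for k using a(2) that by simp
    ultimately show ?thesis by (auto simp: fun_eq_iff n_def s_def)
  qed
  have f: "?f x = (if char_map X \<sigma> x \<in> open_cell X \<epsilon> then n else s)" for x
    using \<epsilon> by (auto simp: attaching_quotient_def disc_collapse_def south_pole_def Let_def
        n_def s_def)
  have eq: "Brouwer_degree2 0 ?f = Brouwer_degree2 0 g" if "?f n = g n" "?f s = g s" for g
  proof (rule Brouwer_degree2_eq)
    show "?f x = g x" if "x \<in> topspace (nsphere 0)" for x
      using ns[OF that] \<open>?f n = g n\<close> \<open>?f s = g s\<close> by (elim disjE) simp_all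
  qed
  define r where "r = (\<lambda>(x :: nat \<Rightarrow> real) i. if i = 0 then - x i else x i)"
  have r: "Brouwer_degree2 0 r = - 1" "r n = s" "r s = n"
    using Brouwer_degree2_reflection[of 0] by (auto simp: r_def n_def s_def fun_eq_iff)
  have inc: "incidence_number X \<sigma> \<epsilon> = Brouwer_degree2 0 ?f"
    by (simp add: incidence_number_def \<epsilon>)
  consider "?N" "?S" | "?N" "\<not> ?S" | "\<not> ?N" "?S" | "\<not> ?N" "\<not> ?S" by blast
  then show ?thesis
  proof cases
    case 1
    then have "Brouwer_degree2 0 ?f = Brouwer_degree2 0 (\<lambda>x. n)" by (intro eq) (simp_all add: f)
    then show ?thesis using 1 by (simp add: inc Brouwer_degree2_const)
  next
    case 2
    then have "Brouwer_degree2 0 ?f = Brouwer_degree2 0 id" by (intro eq) (simp_all add: f)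
    then show ?thesis using 2 by (simp add: inc)
  next
    case 3
    then have "Brouwer_degree2 0 ?f = Brouwer_degree2 0 r" by (intro eq) (simp_all add: f r)
    then show ?thesis using 3 by (simp add: inc r)
  next
    case 4
    then have "Brouwer_degree2 0 ?f = Brouwer_degree2 0 (\<lambda>x. s)" by (intro eq) (simp_all add: f)
    then show ?thesis using 4 by (simp add: inc Brouwer_degree2_const)
  qed
qed

lemma subcomplex_between_skeleta:
  assumes X: "finite_cell_complex X"
    and P: "skeleton X (int j - 1) \<subseteq> P" "P \<subseteq> skeleton X (int j)"
  shows "subcomplex X P"
  unfolding subcomplex_def
proof (intro conjI ballI)
  show PX: "P \<subseteq> cells X" using P(2) by (auto simp: skeleton_def)
  fix c assume c: "c \<in> P"
  have "char_map X c ` disc_boundary (cell_dim X c)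
          \<subseteq> (\<Union>d\<in>{d \<in> cells X. cell_dim X d < cell_dim X c}. open_cell X d)"
    using X c PX unfolding finite_cell_complex_def by blast
  also have "\<dots> \<subseteq> (\<Union>d\<in>P. open_cell X d)"
    using P c by (intro UN_mono) (force simp: skeleton_def)+
  finally show "char_map X c ` closed_disc (cell_dim X c) \<subseteq> (\<Union>d\<in>P. open_cell X d)"
    using c by (auto simp: disc_split open_cell_def)
qed

lemma percolation_subcomplexes_eq:
  assumes "finite_cell_complex X"
  shows "percolation_subcomplexes X j = {P. skeleton X (int j - 1) \<subseteq> P \<and> P \<subseteq> skeleton X (int j)}"
  using subcomplex_between_skeleta[OF assms] by (auto simp: percolation_subcomplexes_def)

lemma relative_coboundaries_percolation:
  assumes P1: "P1 \<in> percolation_subcomplexes X i"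
    and P2: "P2 \<in> percolation_subcomplexes X (Suc i)" and q: "q > 0"
  shows "relative_coboundaries q X P2 P1 i = {\<lambda>x\<in>oriented_cells X P2 i. 0}"
proof (cases i)
  case 0
  then show ?thesis by (simp add: relative_coboundaries_def)
next
  case (Suc k)
  have sub: "cells_of_dim X P1 k = cells_of_dim X P2 k"
    using P1 P2 Suc by (auto simp: percolation_subcomplexes_def skeleton_def cells_of_dim_def)
  have "coboundary q X P2 k f = (\<lambda>x\<in>oriented_cells X P2 i. 0)"
    if "f \<in> relative_cochains q X P2 P1 k" for f
  proof -
    have "f (\<epsilon>, True) = 0" if "\<epsilon> \<in> cells_of_dim X P2 k" for \<epsilon>
      using \<open>f \<in> _\<close> sub that by (auto simp: relative_cochains_def oriented_cells_def)
    then show ?thesis by (auto simp: coboundary_def Suc fun_eq_iff)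
  qed
  moreover have "(\<lambda>x\<in>oriented_cells X P2 k. 0) \<in> relative_cochains q X P2 P1 k"
    using q by (auto simp: relative_cochains_def cochains_def oriented_cells_def reverse_cell_def
        sub)
  ultimately show ?thesis
    by (auto simp: relative_coboundaries_def Suc image_def)
qed

text \<open>The relative cohomology in the weight has as many elements as the group of cochains that
  vanish on the cells of \<open>P1\<close> and whose coboundary vanishes on the cells of \<open>P2\<close>.\<close>

lemma card_relative_cohomology:
  assumes P1: "P1 \<in> percolation_subcomplexes X i"
    and P2: "P2 \<in> percolation_subcomplexes X (Suc i)" and q: "q > 0"
  shows "card (relative_cohomology q X P2 P1 i) =
    card {f \<in> cochains q X (cells X) i.
      (\<forall>x\<in>oriented_cells X P1 i. f x = 0) \<and>
      (\<forall>x\<in>oriented_cells X P2 (Suc i). coboundary q X (cells X) i f x = 0)}"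
proof -
  let ?Z = "relative_cocycles q X P2 P1 i"
  have PX: "P2 \<subseteq> cells X" using P2 by (auto simp: percolation_subcomplexes_def subcomplex_def)
  have ci: "cells_of_dim X P2 i = cells_of_dim X (cells X) i"
    using P2 by (auto simp: percolation_subcomplexes_def skeleton_def cells_of_dim_def)
  have oi: "oriented_cells X P2 i = oriented_cells X (cells X) i"
    by (simp add: oriented_cells_def ci)
  have co: "cochains q X P2 i = cochains q X (cells X) i"
    by (simp add: cochains_def oi)
  have cb: "coboundary q X P2 i f x = coboundary q X (cells X) i f x"
    if "x \<in> oriented_cells X P2 (Suc i)" for f x
  proof -
    have "x \<in> oriented_cells X (cells X) (Suc i)"
      using that PX by (auto simp: oriented_cells_def cells_of_dim_def)
    then show ?thesis using that by (simp add: coboundary_def ci)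
  qed
  have Z: "?Z = {f \<in> cochains q X (cells X) i.
      (\<forall>x\<in>oriented_cells X P1 i. f x = 0) \<and>
      (\<forall>x\<in>oriented_cells X P2 (Suc i). coboundary q X (cells X) i f x = 0)}"
    using cb by (auto simp: relative_cocycles_def relative_cochains_def co)
  have eqI: "f = g" if fg: "f \<in> ?Z" "g \<in> ?Z"
      and eq: "\<forall>x\<in>oriented_cells X P2 i. f x = (g x + (\<lambda>x\<in>oriented_cells X P2 i. 0) x) mod int q" for f g
  proof (rule PiE_ext)
    show "f \<in> oriented_cells X P2 i \<rightarrow>\<^sub>E {0..<int q}" "g \<in> oriented_cells X P2 i \<rightarrow>\<^sub>E {0..<int q}"
      using fg by (auto simp: relative_cocycles_def relative_cochains_def cochains_def)
    then show "f x = g x" if "x \<in> oriented_cells X P2 i" for x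
      using eq that by (auto dest!: PiE_mem)
  qed
  have refl: "\<forall>x\<in>oriented_cells X P2 i. f x = (f x + (\<lambda>x\<in>oriented_cells X P2 i. 0) x) mod int q"
    if "f \<in> ?Z" for f
  proof
    fix x assume x: "x \<in> oriented_cells X P2 i"
    then have "f x \<in> {0..<int q}"
      using that by (auto simp: relative_cocycles_def relative_cochains_def cochains_def)
    then show "f x = (f x + (\<lambda>x\<in>oriented_cells X P2 i. 0) x) mod int q" using x by simp
  qed
  have "{(f, g). f \<in> ?Z \<and> g \<in> ?Z \<and> (\<exists>h\<in>relative_coboundaries q X P2 P1 i.
             \<forall>x\<in>oriented_cells X P2 i. f x = (g x + h x) mod int q)} = Id_on ?Z"
    unfolding relative_coboundaries_percolation[OF P1 P2 q]
    using eqI refl by (auto simp: Id_on_def)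
  then have "relative_cohomology q X P2 P1 i = (\<lambda>f. {f}) ` ?Z"
    by (auto simp: relative_cohomology_def quotient_def)
  then have "card (relative_cohomology q X P2 P1 i) = card ?Z"
    by (simp add: card_image inj_on_def)
  then show ?thesis by (simp add: Z)
qed

lemma finite_percolation_subcomplexes:
  assumes "finite_cell_complex X"
  shows "finite (percolation_subcomplexes X j)"
proof (rule finite_subset)
  show "percolation_subcomplexes X j \<subseteq> Pow (cells X)"
    by (auto simp: percolation_subcomplexes_def subcomplex_def)
  show "finite (Pow (cells X))" using assms by (simp add: finite_cell_complex_def)
qed

lemma bernoulli_weight_nonneg: "0 \<le> p \<Longrightarrow> p \<le> 1 \<Longrightarrow> 0 \<le> bernoulli_weight X j p P"
  by (simp add: bernoulli_weight_def)

lemma bernoulli_weight_pos: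
  assumes X: "finite_cell_complex X" and p: "0 \<le> p" "p \<le> 1"
  shows "\<exists>P\<in>percolation_subcomplexes X j. 0 < bernoulli_weight X j p P"
proof (cases "p = 1")
  case True
  have "cells_of_dim X (skeleton X (int j)) j = cells_of_dim X (cells X) j"
    by (auto simp: skeleton_def cells_of_dim_def)
  then have "0 < bernoulli_weight X j p (skeleton X (int j))"
    using True by (simp add: bernoulli_weight_def)
  moreover have "skeleton X (int j) \<in> percolation_subcomplexes X j"
    unfolding percolation_subcomplexes_eq[OF X] by (auto simp: skeleton_def)
  ultimately show ?thesis by blast
next
  case False
  have "cells_of_dim X (skeleton X (int j - 1)) j = {}"
    by (auto simp: skeleton_def cells_of_dim_def)
  then have "0 < bernoulli_weight X j p (skeleton X (int j - 1))"
    using False p by (simp add: bernoulli_weight_def)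
  moreover have "skeleton X (int j - 1) \<in> percolation_subcomplexes X j"
    unfolding percolation_subcomplexes_eq[OF X] by (auto simp: skeleton_def)
  ultimately show ?thesis by blast
qed

lemma card_relative_cohomology_pos:
  assumes X: "finite_cell_complex X" and P1: "P1 \<in> percolation_subcomplexes X i"
    and P2: "P2 \<in> percolation_subcomplexes X (Suc i)" and q: "q > 0"
  shows "0 < card (relative_cohomology q X P2 P1 i)"
proof -
  let ?S = "{f \<in> cochains q X (cells X) i.
      (\<forall>x\<in>oriented_cells X P1 i. f x = 0) \<and>
      (\<forall>x\<in>oriented_cells X P2 (Suc i). coboundary q X (cells X) i f x = 0)}"
  let ?z = "\<lambda>x\<in>oriented_cells X (cells X) i. 0 :: int"
  have sub: "P1 \<subseteq> cells X" "P2 \<subseteq> cells X"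
    using P1 P2 by (auto simp: percolation_subcomplexes_def subcomplex_def)
  have "finite (oriented_cells X (cells X) i)"
    using X by (auto simp: finite_cell_complex_def oriented_cells_def cells_of_dim_def)
  then have "finite (cochains q X (cells X) i)"
    unfolding cochains_def by (intro finite_subset[OF Collect_restrict] finite_PiE) auto
  then have "finite ?S" by simp
  moreover have "?z \<in> ?S"
  proof -
    have "?z \<in> cochains q X (cells X) i"
      using q by (auto simp: cochains_def oriented_cells_def reverse_cell_def)
    moreover have "?z x = 0" if "x \<in> oriented_cells X P1 i" for x
      using that sub(1) by (auto simp: oriented_cells_def cells_of_dim_def)
    moreover have "coboundary q X (cells X) i ?z x = 0" if "x \<in> oriented_cells X P2 (Suc i)" for x
    proof -
      have "x \<in> oriented_cells X (cells X) (Suc i)"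
        using that sub(2) by (auto simp: oriented_cells_def cells_of_dim_def)
      moreover have "?z (\<epsilon>, True) = 0" if "\<epsilon> \<in> cells_of_dim X (cells X) i" for \<epsilon>
        using that by (simp add: oriented_cells_def)
      ultimately show ?thesis by (simp add: coboundary_def)
    qed
    ultimately show ?thesis by blast
  qed
  ultimately show ?thesis
    unfolding card_relative_cohomology[OF P1 P2 q] by (auto simp: card_gt_0_iff)
qed

lemma prob_space_coupled_plaquette_percolation:
  assumes X: "finite_cell_complex X" and q: "prime q"
    and p: "p2 \<in> {0..1}" "p1 \<in> {0..1}"
  shows "prob_space (coupled_plaquette_percolation p2 p1 q i X)"
proof
  let ?C = "coupled_configs X i" and ?w = "coupled_weight p2 p1 q i X"
  have fin: "finite ?C"
    by (simp add: coupled_configs_def finite_percolation_subcomplexes[OF X])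
  have nn: "0 \<le> ?w \<omega>" for \<omega>
    using p by (auto simp: coupled_weight_def bernoulli_weight_nonneg split: prod.split)
  obtain P1 P2 where P: "P1 \<in> percolation_subcomplexes X i" "0 < bernoulli_weight X i p1 P1"
      "P2 \<in> percolation_subcomplexes X (Suc i)" "0 < bernoulli_weight X (Suc i) p2 P2"
    using bernoulli_weight_pos[OF X, of p1 i] bernoulli_weight_pos[OF X, of p2 "Suc i"] p
    by auto
  have "0 < ?w (P2, P1)"
    using P card_relative_cohomology_pos[OF X P(1,3)] prime_gt_0_nat[OF q]
    by (simp add: coupled_weight_def)
  moreover have "(P2, P1) \<in> ?C" using P by (simp add: coupled_configs_def)
  ultimately have Z: "0 < sum ?w ?C" using fin nn by (intro sum_pos2) auto
  have "emeasure (coupled_plaquette_percolation p2 p1 q i X) ?C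
      = (\<Sum>\<omega>\<in>?C. ennreal (?w \<omega> / sum ?w ?C))"
    by (simp add: coupled_plaquette_percolation_def emeasure_point_measure_finite[OF fin])
  also have "\<dots> = ennreal (\<Sum>\<omega>\<in>?C. ?w \<omega> / sum ?w ?C)"
    using nn Z by (intro sum_ennreal) (simp add: divide_nonneg_pos)
  also have "\<dots> = 1" using Z by (simp flip: sum_divide_distrib)
  finally show "emeasure (coupled_plaquette_percolation p2 p1 q i X)
      (space (coupled_plaquette_percolation p2 p1 q i X)) = 1"
    by (simp add: coupled_plaquette_percolation_def space_point_measure)
qed

end

theory Submission
  imports Defs
begin

text \<open>The percolation subcomplexes of a given dimension form a lattice of sets under union and
  intersection, so by the FKG inequality it is enough that the weight of the measure is
  log-supermodular:
  \<open>w \<omega> * w \<eta> \<le> w (\<omega> \<union> \<eta>) * w (\<omega> \<inter> \<eta>)\<close>, with componentwise operations on pairs.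

  The two Bernoulli factors satisfy this with equality (\<open>bernoulli_weight_modular\<close>). The
  cohomological factor is the number of cochains subject to one linear constraint for each
  \<open>i\<close>-cell of \<open>P1\<close> and each \<open>(i + 1)\<close>-cell of \<open>P2\<close>. Such cochains form a subgroup of a finite abelian group.
  Let \<open>H\<close> and \<open>K\<close> be the subgroups of two configurations. Imposing the constraints of both gives
  exactly \<open>H \<inter> K\<close>, while imposing only the common ones gives a group that contains \<open>H\<close> and \<open>K\<close>,
  hence \<open>H + K\<close>. As \<open>|H| |K| = |H \<inter> K| |H + K|\<close>, supermodularity follows
  (\<open>card_constrained_cochains_supermodular\<close>).

  The FKG inequality is derived from the four functions theorem of Ahlswede and Daykin.\<close>

section \<open>The four functions theorem and the FKG inequality\<close>

text \<open>This is the four functions theorem for the subsets of a single point, where index \<open>0\<close> stands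
  for the empty set. The diagonal products are bounded termwise, but both mixed terms
  \<open>p = a0 * b1\<close> and \<open>r = a1 * b0\<close> have the same bound \<open>u = c1 * d0\<close>, and it may be used only once.
  The remaining product \<open>c0 * d1\<close> makes up for this: multiplying the two diagonal hypotheses gives
  \<open>p * r \<le> u * (c0 * d1)\<close>, and \<open>(u - p) * (u - r) \<ge> 0\<close> then gives \<open>p + r \<le> u + c0 * d1\<close>.\<close>

lemma four_functions_two_points:
  fixes a0 a1 b0 b1 c0 c1 d0 d1 :: "'r :: linordered_idom"
  assumes nonneg: "0 \<le> a0" "0 \<le> a1" "0 \<le> b0" "0 \<le> b1" "0 \<le> c0" "0 \<le> c1" "0 \<le> d0" "0 \<le> d1"
    and 00: "a0 * b0 \<le> c0 * d0" and 01: "a0 * b1 \<le> c1 * d0"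
    and 10: "a1 * b0 \<le> c1 * d0" and 11: "a1 * b1 \<le> c1 * d1"
  shows "(a0 + a1) * (b0 + b1) \<le> (c0 + c1) * (d0 + d1)"
proof -
  define u p r where "u = c1 * d0" and "p = a0 * b1" and "r = a1 * b0"
  have p: "0 \<le> p" "p \<le> u" and r: "0 \<le> r" "r \<le> u"
    using nonneg 01 10 by (auto simp: u_def p_def r_def)
  have "p + r \<le> u + c0 * d1"
  proof (cases "u = 0")
    case True
    then show ?thesis using p r nonneg by simp
  next
    case False
    then have u: "0 < u" using p by simp
    have "p * r = (a0 * b0) * (a1 * b1)" by (simp add: p_def r_def mult_ac)
    also have "\<dots> \<le> (c0 * d0) * (c1 * d1)" using 00 11 nonneg by (intro mult_mono[OF 00 11]) auto
    also have "\<dots> = u * (c0 * d1)" by (simp add: u_def mult_ac)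
    finally have "p * r \<le> u * (c0 * d1)" .
    moreover have "0 \<le> (u - p) * (u - r)" using p r by simp
    ultimately have "u * (p + r) \<le> u * (u + c0 * d1)" by (simp add: algebra_simps)
    then show ?thesis using u by simp
  qed
  then show ?thesis using 00 11 by (simp add: u_def p_def r_def algebra_simps)
qed

lemma sum_Pow_insert:
  assumes "finite E" "x \<notin> E"
  shows "sum f (Pow (insert x E)) = (\<Sum>S\<in>Pow E. f S + f (insert x S))"
proof -
  have "inj_on (insert x) (Pow E)" using assms by (auto simp: inj_on_def)
  moreover have "Pow E \<inter> insert x ` Pow E = {}" using assms by auto
  ultimately show ?thesis
    using assms by (simp add: Pow_insert sum.union_disjoint sum.reindex sum.distrib)
qed

text \<open>The induction removes one point \<open>x\<close> of the ground set: each function is replaced by its sum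
  over the two ways of deciding whether \<open>x\<close> belongs to the set. The two-point inequality says that
  the hypothesis survives this summation.\<close>

theorem four_functions:
  fixes a b c d :: "'a set \<Rightarrow> 'r :: linordered_idom"
  assumes "finite E"
    and "\<And>S. S \<subseteq> E \<Longrightarrow> 0 \<le> a S" "\<And>S. S \<subseteq> E \<Longrightarrow> 0 \<le> b S"
    and "\<And>S. S \<subseteq> E \<Longrightarrow> 0 \<le> c S" "\<And>S. S \<subseteq> E \<Longrightarrow> 0 \<le> d S"
    and "\<And>S T. S \<subseteq> E \<Longrightarrow> T \<subseteq> E \<Longrightarrow> a S * b T \<le> c (S \<union> T) * d (S \<inter> T)"
  shows "sum a (Pow E) * sum b (Pow E) \<le> sum c (Pow E) * sum d (Pow E)"
  using assms
proof (induction E arbitrary: a b c d rule: finite_induct)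
  case empty
  then show ?case using empty(5)[of "{}" "{}"] by simp
next
  case (insert x E)
  note nonneg = insert.prems(1-4) and le = insert.prems(5)
  let ?m = "\<lambda>f S. f S + f (insert x S) :: 'r"
  have "sum (?m a) (Pow E) * sum (?m b) (Pow E) \<le> sum (?m c) (Pow E) * sum (?m d) (Pow E)"
  proof (rule insert.IH)
    fix S T assume S: "S \<subseteq> E" and T: "T \<subseteq> E"
    have x: "x \<notin> S" "x \<notin> T" using S T insert.hyps by auto
    have sub: "S \<subseteq> insert x E" "T \<subseteq> insert x E" "insert x S \<subseteq> insert x E" "insert x T \<subseteq> insert x E"
      "S \<union> T \<subseteq> insert x E" "S \<inter> T \<subseteq> insert x E"
      "insert x (S \<union> T) \<subseteq> insert x E" "insert x (S \<inter> T) \<subseteq> insert x E"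
      using S T by auto
    show "?m a S * ?m b T \<le> ?m c (S \<union> T) * ?m d (S \<inter> T)"
      using le[of S T] le[of S "insert x T"] le[of "insert x S" T] le[of "insert x S" "insert x T"]
        sub x by (intro four_functions_two_points nonneg) auto
  qed (auto intro!: add_nonneg_nonneg nonneg)
  then show ?case using insert.hyps by (simp add: sum_Pow_insert)
qed

text \<open>Applying the theorem to the second component, for fixed first components, yields its
  hypothesis for the marginals on the first component.\<close>

lemma four_functions_pairs:
  fixes a b c d :: "'a set \<Rightarrow> 'b set \<Rightarrow> 'r :: linordered_idom"
  assumes E: "finite E" and F: "finite F"
    and nonneg: "\<And>S T. 0 \<le> a S T" "\<And>S T. 0 \<le> b S T" "\<And>S T. 0 \<le> c S T" "\<And>S T. 0 \<le> d S T"
    and le: "\<And>S T S' T'. S \<subseteq> E \<Longrightarrow> T \<subseteq> F \<Longrightarrow> S' \<subseteq> E \<Longrightarrow> T' \<subseteq> F \<Longrightarrow>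
      a S T * b S' T' \<le> c (S \<union> S') (T \<union> T') * d (S \<inter> S') (T \<inter> T')"
  shows "(\<Sum>S\<in>Pow E. sum (a S) (Pow F)) * (\<Sum>S\<in>Pow E. sum (b S) (Pow F))
    \<le> (\<Sum>S\<in>Pow E. sum (c S) (Pow F)) * (\<Sum>S\<in>Pow E. sum (d S) (Pow F))"
  by (intro four_functions E F sum_nonneg nonneg le)

text \<open>Apply the four functions theorem to the restrictions of \<open>w\<close> to \<open>A\<close>, \<open>B\<close>, \<open>A \<inter> B\<close> and \<open>D\<close>,
  extended by zero: if \<open>\<omega> \<in> A\<close> and \<open>\<eta> \<in> B\<close>, then monotonicity puts \<open>\<omega> \<union> \<eta>\<close> into \<open>A \<inter> B\<close>. The
  extension by zero makes the inequality available on every sublattice \<open>D\<close> of the pairs of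
  subsets.\<close>

theorem FKG_inequality:
  fixes w :: "'a set \<times> 'b set \<Rightarrow> 'r :: linordered_idom"
  assumes E: "finite E" and F: "finite F" and D: "D \<subseteq> Pow E \<times> Pow F"
    and nonneg: "\<And>\<omega>. \<omega> \<in> D \<Longrightarrow> 0 \<le> w \<omega>"
    and lattice: "\<And>S T S' T'. (S, T) \<in> D \<Longrightarrow> (S', T') \<in> D \<Longrightarrow>
      (S \<union> S', T \<union> T') \<in> D \<and> (S \<inter> S', T \<inter> T') \<in> D"
    and supermodular: "\<And>S T S' T'. (S, T) \<in> D \<Longrightarrow> (S', T') \<in> D \<Longrightarrow>
      w (S, T) * w (S', T') \<le> w (S \<union> S', T \<union> T') * w (S \<inter> S', T \<inter> T')"
    and A: "A \<subseteq> D" "\<And>S T S' T'. (S, T) \<in> A \<Longrightarrow> (S', T') \<in> D \<Longrightarrow> (S \<union> S', T \<union> T') \<in> A"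
    and B: "B \<subseteq> D" "\<And>S T S' T'. (S, T) \<in> B \<Longrightarrow> (S', T') \<in> D \<Longrightarrow> (S \<union> S', T \<union> T') \<in> B"
  shows "sum w A * sum w B \<le> sum w (A \<inter> B) * sum w D"
proof -
  define g where "g V S T = (if (S, T) \<in> V then w (S, T) else 0)" for V S T
  have g_sum: "sum w V = (\<Sum>S\<in>Pow E. sum (g V S) (Pow F))" if "V \<subseteq> D" for V
  proof -
    have "(\<Sum>S\<in>Pow E. sum (g V S) (Pow F)) = (\<Sum>\<omega>\<in>Pow E \<times> Pow F. if \<omega> \<in> V then w \<omega> else 0)"
      unfolding g_def sum.cartesian_product by (rule sum.cong) auto
    also have "\<dots> = sum w (Pow E \<times> Pow F \<inter> V)" 
      using E F by (simp add: sum.inter_restrict)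
    also have "Pow E \<times> Pow F \<inter> V = V" using that D by blast
    finally show ?thesis by simp
  qed
  have g_nonneg: "0 \<le> g V S T" if "V \<subseteq> D" for V S T
    using that nonneg by (auto simp: g_def)
  have "g A S T * g B S' T' \<le> g (A \<inter> B) (S \<union> S') (T \<union> T') * g D (S \<inter> S') (T \<inter> T')" for S T S' T'
  proof (cases "(S, T) \<in> A \<and> (S', T') \<in> B")
    case True
    then have st: "(S, T) \<in> D" "(S', T') \<in> D" using A(1) B(1) by auto
    have "(S \<union> S', T \<union> T') \<in> A \<inter> B"
      using A(2)[of S T S' T'] B(2)[of S' T' S T] True st by (simp add: Un_commute)
    then show ?thesis
      using True st lattice[OF st] supermodular[OF st] by (simp add: g_def)
  next
    case False
    then have "g A S T * g B S' T' = 0" by (auto simp: g_def)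
    moreover have "A \<inter> B \<subseteq> D" using A(1) by blast
    ultimately show ?thesis by (metis g_nonneg mult_nonneg_nonneg subset_refl)
  qed
  moreover have "A \<inter> B \<subseteq> D" using A(1) by blast
  ultimately have "(\<Sum>S\<in>Pow E. sum (g A S) (Pow F)) * (\<Sum>S\<in>Pow E. sum (g B S) (Pow F))
    \<le> (\<Sum>S\<in>Pow E. sum (g (A \<inter> B) S) (Pow F)) * (\<Sum>S\<in>Pow E. sum (g D S) (Pow F))"
    using A(1) B(1) E F by (intro four_functions_pairs g_nonneg) auto
  then show ?thesis
    using A(1) B(1) \<open>A \<inter> B \<subseteq> D\<close> by (simp add: g_sum)
qed

section \<open>Orders of subgroups\<close>

text \<open>The multiplication map from \<open>H \<times> K\<close> to \<open>M\<close> has fibres with at most \<open>card (H \<inter> K)\<close> elements: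
  if \<open>h \<otimes> k = h0 \<otimes> k0\<close>, then \<open>inv h0 \<otimes> h = k0 \<otimes> inv k\<close> lies in both subgroups, and it determines
  \<open>h\<close> and thus \<open>k\<close>.\<close>

lemma (in group) card_subgroups_mult_le:
  assumes H: "subgroup H G" and K: "subgroup K G" and M: "subgroup M G"
    and sub: "H \<subseteq> M" "K \<subseteq> M" and fin: "finite M"
  shows "card H * card K \<le> card M * card (H \<inter> K)"
proof -
  interpret H: subgroup H G by fact
  interpret K: subgroup K G by fact
  interpret M: subgroup M G by fact
  define F where "F m = {(h, k) \<in> H \<times> K. h \<otimes> k = m}" for m
  have fin': "finite (H \<inter> K)" using fin sub finite_subset by blast
  have fibre: "card (F m) \<le> card (H \<inter> K)" for m
  proof (cases "F m = {}")
    case False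
    then obtain h0 k0 where 0: "h0 \<in> H" "k0 \<in> K" "h0 \<otimes> k0 = m" by (auto simp: F_def)
    show ?thesis
    proof (rule card_inj_on_le[OF _ _ fin'])
      show "inj_on (\<lambda>(h, k). inv h0 \<otimes> h) (F m)"
        using 0(1) by (auto simp: inj_on_def F_def)
      show "(\<lambda>(h, k). inv h0 \<otimes> h) ` F m \<subseteq> H \<inter> K"
      proof clarify
        fix h k assume "(h, k) \<in> F m"
        then have hk: "h \<in> H" "k \<in> K" "h \<otimes> k = h0 \<otimes> k0" using 0 by (auto simp: F_def)
        have "inv h0 \<otimes> h = inv h0 \<otimes> (h \<otimes> k) \<otimes> inv k"
          using 0 hk(1,2) by (simp add: m_assoc)
        also have "\<dots> = k0 \<otimes> inv k"
          using 0(1,2) hk(1,2) unfolding hk(3) by (simp add: m_assoc[symmetric])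
        finally have "inv h0 \<otimes> h = k0 \<otimes> inv k" .
        then have "inv h0 \<otimes> h \<in> K" using 0(2) hk(2) by simp
        then show "inv h0 \<otimes> h \<in> H \<inter> K" using 0(1) hk(1) by simp
      qed
    qed
  qed simp
  have "H \<times> K = (\<Union>m\<in>M. F m)" using sub by (auto simp: F_def)
  then have "card H * card K = card (\<Union>m\<in>M. F m)" by (simp flip: card_cartesian_product)
  also have "\<dots> \<le> (\<Sum>m\<in>M. card (F m))" using fin by (rule card_UN_le)
  also have "\<dots> \<le> card M * card (H \<inter> K)" using sum_bounded_above[of M, OF fibre] by simp
  finally show ?thesis .
qed

section \<open>Cochains subject to constraints\<close>

text \<open>All residue-valued functions on the oriented cells are admitted, including those that do not
  change sign under reversal; the antisymmetric ones are singled out by \<open>cochains\<close>.\<close>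

abbreviation cochain_group ::
  "nat \<Rightarrow> ('a, 'c) cell_complex \<Rightarrow> nat \<Rightarrow> ('c oriented_cell \<Rightarrow> int) monoid" where
  "cochain_group q X i \<equiv>
     product_group (oriented_cells X (cells X) i) (\<lambda>_. integer_mod_group q)"

text \<open>For percolation subcomplexes, this set has the order of the relative cohomology group in the
  weight of the coupled percolation, by \<open>card_relative_cohomology\<close>.\<close>

definition constrained_cochains ::
  "nat \<Rightarrow> ('a, 'c) cell_complex \<Rightarrow> nat \<Rightarrow> 'c set \<Rightarrow> 'c set \<Rightarrow> ('c oriented_cell \<Rightarrow> int) set" where
  "constrained_cochains q X i P2 P1 = {f \<in> cochains q X (cells X) i.
      (\<forall>x\<in>oriented_cells X P1 i. f x = 0) \<and>
      (\<forall>x\<in>oriented_cells X P2 (Suc i). coboundary q X (cells X) i f x = 0)}"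

lemma cells_of_dim_Un: "cells_of_dim X (P \<union> Q) j = cells_of_dim X P j \<union> cells_of_dim X Q j"
  and cells_of_dim_Int: "cells_of_dim X (P \<inter> Q) j = cells_of_dim X P j \<inter> cells_of_dim X Q j"
  by (auto simp: cells_of_dim_def)

lemma constrained_cochains_Un:
  "constrained_cochains q X i (P2 \<union> Q2) (P1 \<union> Q1)
    = constrained_cochains q X i P2 P1 \<inter> constrained_cochains q X i Q2 Q1"
  by (auto simp: constrained_cochains_def oriented_cells_def cells_of_dim_Un)

lemma constrained_cochains_antimono:
  "P2 \<subseteq> Q2 \<Longrightarrow> P1 \<subseteq> Q1 \<Longrightarrow> constrained_cochains q X i Q2 Q1 \<subseteq> constrained_cochains q X i P2 P1"
  by (fastforce simp: constrained_cochains_def oriented_cells_def cells_of_dim_def)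

lemma finite_cochains:
  assumes "finite_cell_complex X"
  shows "finite (cochains q X (cells X) i)"
proof -
  have "finite (oriented_cells X (cells X) i)"
    using assms by (auto simp: finite_cell_complex_def oriented_cells_def cells_of_dim_def)
  then show ?thesis
    unfolding cochains_def by (intro finite_subset[OF Collect_restrict] finite_PiE) auto
qed

lemma mod_linear_combination:
  fixes a b u v m :: int
  shows "(a * (u mod m) + b * (v mod m)) mod m = (a * u + b * v) mod m"
  by (intro mod_add_cong) (simp_all add: mod_mult_right_eq)

lemma coboundary_linear_combination:
  assumes "x \<in> oriented_cells X P (Suc i)"
  shows "coboundary q X P i (\<lambda>y\<in>oriented_cells X P i. (a * f y + b * g y) mod int q) x
    = (a * coboundary q X P i f x + b * coboundary q X P i g x) mod int q"
proof -
  let ?C = "cells_of_dim X P i" and ?s = "\<lambda>h. \<Sum>\<epsilon>\<in>cells_of_dim X P i. cell_boundary X x \<epsilon> * h (\<epsilon>, True)"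
  have "(\<Sum>\<epsilon>\<in>?C. cell_boundary X x \<epsilon> * ((a * f (\<epsilon>, True) + b * g (\<epsilon>, True)) mod int q)) mod int q
      = (\<Sum>\<epsilon>\<in>?C. cell_boundary X x \<epsilon> * (a * f (\<epsilon>, True) + b * g (\<epsilon>, True))) mod int q"
    by (subst (1 2) mod_sum_eq[symmetric]) (simp add: mod_mult_right_eq)
  also have "(\<Sum>\<epsilon>\<in>?C. cell_boundary X x \<epsilon> * (a * f (\<epsilon>, True) + b * g (\<epsilon>, True))) = a * ?s f + b * ?s g"
    by (simp add: sum_distrib_left sum.distrib[symmetric] algebra_simps)
  also have "\<dots> mod int q = (a * (?s f mod int q) + b * (?s g mod int q)) mod int q"
    by (rule mod_linear_combination[symmetric])
  finally show ?thesis
    using assms by (simp add: coboundary_def oriented_cells_def)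
qed

text \<open>Arbitrary integer coefficients give both closure properties of a subgroup at once: \<open>1, 1\<close> for
  sums and \<open>- 1, 0\<close> for inverses.\<close>

lemma constrained_cochains_linear_combination:
  assumes f: "f \<in> constrained_cochains q X i P2 P1" and g: "g \<in> constrained_cochains q X i P2 P1"
    and P: "P2 \<subseteq> cells X" "P1 \<subseteq> cells X" and q: "q > 0"
  shows "(\<lambda>x\<in>oriented_cells X (cells X) i. (a * f x + b * g x) mod int q)
    \<in> constrained_cochains q X i P2 P1" (is "?h \<in> _")
proof -
  let ?I = "oriented_cells X (cells X) i"
  have "?h (reverse_cell x) = (- ?h x) mod int q" if x: "x \<in> ?I" for x
  proof -
    have "reverse_cell x \<in> ?I" using x by (auto simp: oriented_cells_def reverse_cell_def)
    moreover have "f (reverse_cell x) = (- f x) mod int q" "g (reverse_cell x) = (- g x) mod int q"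
      using f g x by (auto simp: constrained_cochains_def cochains_def)
    ultimately show ?thesis
      using x by (simp add: mod_linear_combination mod_minus_eq algebra_simps)
  qed
  then have "?h \<in> cochains q X (cells X) i" using q by (simp add: cochains_def)
  moreover have "?h x = 0" if "x \<in> oriented_cells X P1 i" for x
    using that f g P by (auto simp: constrained_cochains_def oriented_cells_def cells_of_dim_def)
  moreover have "coboundary q X (cells X) i ?h x = 0" if x: "x \<in> oriented_cells X P2 (Suc i)" for x
  proof -
    have "x \<in> oriented_cells X (cells X) (Suc i)"
      using x P by (auto simp: oriented_cells_def cells_of_dim_def)
    then show ?thesis
      using f g x by (simp add: coboundary_linear_combination constrained_cochains_def)
  qed
  ultimately show ?thesis by (simp add: constrained_cochains_def)
qed

lemma subgroup_constrained_cochains: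
  assumes P: "P2 \<subseteq> cells X" "P1 \<subseteq> cells X" and q: "q > 0"
  shows "subgroup (constrained_cochains q X i P2 P1) (cochain_group q X i)"
proof -
  let ?Z = "constrained_cochains q X i P2 P1" and ?I = "oriented_cells X (cells X) i"
  note comb = constrained_cochains_linear_combination[OF _ _ P q, of _ i]
  interpret group "cochain_group q X i" by simp
  have ZI: "?Z \<subseteq> carrier (cochain_group q X i)"
    using q by (auto simp: constrained_cochains_def cochains_def carrier_integer_mod_group)
  have zero: "(\<lambda>x\<in>?I. 0) \<in> ?Z"
  proof -
    have "(\<lambda>x\<in>?I. 0) \<in> cochains q X (cells X) i"
      using q by (auto simp: cochains_def oriented_cells_def reverse_cell_def)
    moreover have "(\<lambda>x\<in>?I. 0) x = 0" if "x \<in> oriented_cells X P1 i" for x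
      using that P by (auto simp: oriented_cells_def cells_of_dim_def)
    moreover have "coboundary q X (cells X) i (\<lambda>x\<in>?I. 0) x = 0"
      if "x \<in> oriented_cells X P2 (Suc i)" for x
      using that P by (auto simp: coboundary_def oriented_cells_def cells_of_dim_def)
    ultimately show ?thesis unfolding constrained_cochains_def by blast
  qed
  show ?thesis
  proof (rule subgroupI)
    show "?Z \<subseteq> carrier (cochain_group q X i)" by (rule ZI)
    show "?Z \<noteq> {}" using zero by blast
    show "inv\<^bsub>cochain_group q X i\<^esub> f \<in> ?Z" if f: "f \<in> ?Z" for f
    proof -
      have fI: "f \<in> ?I \<rightarrow>\<^sub>E carrier (integer_mod_group q)" using f ZI by auto
      then have "inv\<^bsub>cochain_group q X i\<^esub> f = (\<lambda>x\<in>?I. (- f x) mod int q)"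
        by (auto simp: fun_eq_iff restrict_def dest: PiE_mem)
      then show ?thesis using comb[OF f f, of "- 1" 0] by simp
    qed
    show "f \<otimes>\<^bsub>cochain_group q X i\<^esub> g \<in> ?Z" if "f \<in> ?Z" "g \<in> ?Z" for f g
      using comb[OF that, of 1 1] by simp
  qed
qed

text \<open>The union of two sets of constraints cuts out the intersection of the two subgroups, and each
  subgroup lies in the one cut out by the common constraints.\<close>

lemma card_constrained_cochains_supermodular:
  assumes X: "finite_cell_complex X" and q: "q > 0"
    and P: "P2 \<subseteq> cells X" "P1 \<subseteq> cells X" and Q: "Q2 \<subseteq> cells X" "Q1 \<subseteq> cells X"
  shows "card (constrained_cochains q X i P2 P1) * card (constrained_cochains q X i Q2 Q1)
    \<le> card (constrained_cochains q X i (P2 \<union> Q2) (P1 \<union> Q1)) *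
      card (constrained_cochains q X i (P2 \<inter> Q2) (P1 \<inter> Q1))"
proof -
  interpret group "cochain_group q X i" by simp
  have "finite (constrained_cochains q X i (P2 \<inter> Q2) (P1 \<inter> Q1))"
    using finite_cochains[OF X] by (simp add: constrained_cochains_def)
  moreover have "P2 \<inter> Q2 \<subseteq> cells X" "P1 \<inter> Q1 \<subseteq> cells X" using P by auto
  ultimately show ?thesis
    unfolding constrained_cochains_Un
    using P Q q
    by (subst mult.commute[of "card (_ \<inter> _)"])
      (intro card_subgroups_mult_le subgroup_constrained_cochains constrained_cochains_antimono; auto)
qed

section \<open>Positive association\<close>

lemma percolation_subcomplexes_Un_Int:
  assumes "finite_cell_complex X"
    and "P \<in> percolation_subcomplexes X j" "Q \<in> percolation_subcomplexes X j"
  shows "P \<union> Q \<in> percolation_subcomplexes X j" "P \<inter> Q \<in> percolation_subcomplexes X j"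
  using assms by (auto simp: percolation_subcomplexes_eq)

text \<open>The numbers of open and of closed cells are both modular functions of the subcomplex, and the
  weight is exponential in them.\<close>

lemma bernoulli_weight_modular:
  assumes X: "finite_cell_complex X" and P: "P \<subseteq> cells X" "Q \<subseteq> cells X"
  shows "bernoulli_weight X j p P * bernoulli_weight X j p Q
    = bernoulli_weight X j p (P \<union> Q) * bernoulli_weight X j p (P \<inter> Q)"
proof -
  let ?n = "\<lambda>S. card (cells_of_dim X S j)"
  have fin: "finite (cells_of_dim X S j)" if "S \<subseteq> cells X" for S
    using X that by (auto simp: finite_cell_complex_def cells_of_dim_def intro: finite_subset)
  have eq: "?n P + ?n Q = ?n (P \<union> Q) + ?n (P \<inter> Q)"
    unfolding cells_of_dim_Un cells_of_dim_Int using fin P by (intro card_Un_Int) auto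
  have le: "?n S \<le> ?n (cells X)" if "S \<subseteq> cells X" for S
    using fin[of "cells X"] that by (intro card_mono) (auto simp: cells_of_dim_def)
  have eq': "(?n (cells X) - ?n P) + (?n (cells X) - ?n Q)
      = (?n (cells X) - ?n (P \<union> Q)) + (?n (cells X) - ?n (P \<inter> Q))"
    using eq le[of P] le[of Q] le[of "P \<union> Q"] le[of "P \<inter> Q"] P by (simp add: le_infI1)
  have "bernoulli_weight X j p S * bernoulli_weight X j p T
      = p ^ (?n S + ?n T) * (1 - p) ^ ((?n (cells X) - ?n S) + (?n (cells X) - ?n T))" for S T
    by (simp add: bernoulli_weight_def power_add mult_ac)
  then show ?thesis by (simp only: eq eq')
qed

lemma coupled_weight_supermodular:
  assumes X: "finite_cell_complex X" and q: "q > 0" and p: "p2 \<in> {0..1}" "p1 \<in> {0..1}"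
    and P: "(P2, P1) \<in> coupled_configs X i" and Q: "(Q2, Q1) \<in> coupled_configs X i"
  shows "coupled_weight p2 p1 q i X (P2, P1) * coupled_weight p2 p1 q i X (Q2, Q1)
    \<le> coupled_weight p2 p1 q i X (P2 \<union> Q2, P1 \<union> Q1) *
      coupled_weight p2 p1 q i X (P2 \<inter> Q2, P1 \<inter> Q1)"
proof -
  define z where "z S2 S1 = real (card (constrained_cochains q X i S2 S1))" for S2 S1
  let ?b = "\<lambda>S2 S1. bernoulli_weight X (Suc i) p2 S2 * bernoulli_weight X i p1 S1"
  have w: "coupled_weight p2 p1 q i X (S2, S1) = ?b S2 S1 * z S2 S1"
    if "S2 \<in> percolation_subcomplexes X (Suc i)" "S1 \<in> percolation_subcomplexes X i" for S2 S1
    using card_relative_cohomology[OF that(2,1) q]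
    by (simp add: coupled_weight_def z_def constrained_cochains_def)
  have perc: "P2 \<in> percolation_subcomplexes X (Suc i)" "P1 \<in> percolation_subcomplexes X i"
    "Q2 \<in> percolation_subcomplexes X (Suc i)" "Q1 \<in> percolation_subcomplexes X i"
    using P Q by (auto simp: coupled_configs_def)
  then have sub: "P2 \<subseteq> cells X" "P1 \<subseteq> cells X" "Q2 \<subseteq> cells X" "Q1 \<subseteq> cells X"
    by (auto simp: percolation_subcomplexes_def subcomplex_def)
  have "z P2 P1 * z Q2 Q1 \<le> z (P2 \<union> Q2) (P1 \<union> Q1) * z (P2 \<inter> Q2) (P1 \<inter> Q1)"
    using card_constrained_cochains_supermodular[OF X q sub]
    by (simp add: z_def flip: of_nat_mult)
  moreover have "0 \<le> ?b P2 P1 * ?b Q2 Q1" using p by (simp add: bernoulli_weight_nonneg)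
  moreover have "?b P2 P1 * ?b Q2 Q1 = ?b (P2 \<union> Q2) (P1 \<union> Q1) * ?b (P2 \<inter> Q2) (P1 \<inter> Q1)"
    using bernoulli_weight_modular[OF X sub(1,3), of "Suc i" p2]
      bernoulli_weight_modular[OF X sub(2,4), of i p1] by (simp add: mult_ac)
  ultimately have "(?b P2 P1 * ?b Q2 Q1) * (z P2 P1 * z Q2 Q1)
    \<le> (?b (P2 \<union> Q2) (P1 \<union> Q1) * ?b (P2 \<inter> Q2) (P1 \<inter> Q1)) *
      (z (P2 \<union> Q2) (P1 \<union> Q1) * z (P2 \<inter> Q2) (P1 \<inter> Q1))"
    by (metis mult_left_mono)
  then show ?thesis
    using perc percolation_subcomplexes_Un_Int[OF X] by (simp add: w mult_ac)
qed

text \<open>The definition of an increasing event only adds cells of the top dimension. This amounts to the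
  union with another configuration, because all configurations share their lower skeleta.\<close>

lemma increasing_event_Un:
  assumes A: "increasing_event X i A" and P: "(P2, P1) \<in> A" and Q: "(Q2, Q1) \<in> coupled_configs X i"
  shows "(P2 \<union> Q2, P1 \<union> Q1) \<in> A"
proof -
  have eq: "P \<union> Q = P \<union> cells_of_dim X Q j"
    if "P \<in> percolation_subcomplexes X j" "Q \<in> percolation_subcomplexes X j" for P Q j
    using that by (force simp: percolation_subcomplexes_def skeleton_def cells_of_dim_def)
  have "cells_of_dim X Q2 (Suc i) \<subseteq> cells_of_dim X (cells X) (Suc i)"
    "cells_of_dim X Q1 i \<subseteq> cells_of_dim X (cells X) i"
    using Q by (auto simp: coupled_configs_def percolation_subcomplexes_def subcomplex_def
        cells_of_dim_def)
  then have "(P2 \<union> cells_of_dim X Q2 (Suc i), P1 \<union> cells_of_dim X Q1 i) \<in> A"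
    using A P unfolding increasing_event_def by blast
  moreover have "(P2, P1) \<in> coupled_configs X i" using A P unfolding increasing_event_def by blast
  ultimately show ?thesis
    using Q eq[of P2 "Suc i" Q2] eq[of P1 i Q1] by (simp add: coupled_configs_def)
qed

theorem theorem11:
  fixes X :: "('a, 'c) cell_complex" and q i :: nat and p2 p1 :: real
    and A B :: "('c set \<times> 'c set) set"
  assumes "finite_cell_complex X"
    and "prime q"
    and "p2 \<in> {0..1}" and "p1 \<in> {0..1}"
    and "increasing_event X i A" and "increasing_event X i B"
  shows "measure (coupled_plaquette_percolation p2 p1 q i X) (A \<inter> B)
           \<ge> measure (coupled_plaquette_percolation p2 p1 q i X) A *
             measure (coupled_plaquette_percolation p2 p1 q i X) B"
proof -
  note X = assms(1) and p = assms(3,4) and A = assms(5) and B = assms(6)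
  let ?D = "coupled_configs X i" and ?w = "coupled_weight p2 p1 q i X"
    and ?\<rho> = "coupled_plaquette_percolation p2 p1 q i X"
  have q: "q > 0" using assms(2) by (rule prime_gt_0_nat)
  have fin: "finite (cells X)" using X by (simp add: finite_cell_complex_def)
  have D: "?D \<subseteq> Pow (cells X) \<times> Pow (cells X)"
    by (auto simp: coupled_configs_def percolation_subcomplexes_def subcomplex_def)
  have finD: "finite ?D"
    by (simp add: coupled_configs_def finite_percolation_subcomplexes[OF X])
  have nonneg: "0 \<le> ?w \<omega>" for \<omega>
    using p by (auto simp: coupled_weight_def bernoulli_weight_nonneg split: prod.split)
  define Z where "Z = sum ?w ?D"
  have Z: "0 \<le> Z" using nonneg by (simp add: Z_def sum_nonneg)
  have AD: "A \<subseteq> ?D" and BD: "B \<subseteq> ?D" using A B by (auto simp: increasing_event_def)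
  have measure_eq: "measure ?\<rho> V = sum ?w V / Z" if "V \<subseteq> ?D" for V
  proof -
    have "emeasure ?\<rho> V = ennreal (\<Sum>\<omega>\<in>V. ?w \<omega> / Z)"
      unfolding coupled_plaquette_percolation_def Z_def[symmetric]
      using finD that nonneg Z by (simp add: emeasure_point_measure_finite sum_ennreal)
    then have "measure ?\<rho> V = (\<Sum>\<omega>\<in>V. ?w \<omega> / Z)"
      using nonneg Z by (simp add: measure_def sum_nonneg)
    then show ?thesis by (simp add: sum_divide_distrib)
  qed
  have FKG: "sum ?w A * sum ?w B \<le> sum ?w (A \<inter> B) * Z"
    unfolding Z_def
  proof (rule FKG_inequality[OF fin fin D])
    show "(S \<union> S', T \<union> T') \<in> ?D \<and> (S \<inter> S', T \<inter> T') \<in> ?D"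
      if "(S, T) \<in> ?D" "(S', T') \<in> ?D" for S T S' T'
      using that percolation_subcomplexes_Un_Int[OF X] by (simp add: coupled_configs_def)
  qed (use nonneg coupled_weight_supermodular[OF X q p] AD BD
        increasing_event_Un[OF A] increasing_event_Un[OF B] in auto)
  have "measure ?\<rho> A * measure ?\<rho> B = (sum ?w A * sum ?w B) / Z / Z"
    using AD BD by (simp add: measure_eq)
  also have "\<dots> \<le> sum ?w (A \<inter> B) * Z / Z / Z"
    using FKG Z by (intro divide_right_mono)
  \<comment> \<open>This includes the case \<open>Z = 0\<close>, where both quotients are \<open>0\<close>.\<close>
  also have "\<dots> = sum ?w (A \<inter> B) / Z" by simp
  also have "\<dots> = measure ?\<rho> (A \<inter> B)" using AD by (intro measure_eq[symmetric]) auto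
  finally show ?thesis .
qed

end
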